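(* Suppose that $G\in C^2(\mathbb R^{n_x};\mathbb R^K)$ is locally Lipschitz with constant $c_{\mathrm{lip}}>0$ and that there is $b_{\mathrm{res}}>0$ such that $\|G(x_1)-G(x_2)-\mathrm DG(x_2)(x_1-x_2)\|\le b_{\mathrm{res}}\|x_1-x_2\|^2$ for all $x_1,x_2\in\mathbb R^{n_x}$. Then there exists a constant $b_1>0$, independent of $J$, such that for every particle system $u=(u^{(j)})_{j=1,\dots,J}$ in $\mathbb R^{n_x}$ and every $j\in\{1,\dots,J\}$, $$\|C^{u,G}(u)\Gamma^{-1}(G(u^{(j)})-y)-C(u)\nabla\Phi(u^{(j)})\|\le b_1\,J\,\sqrt{\Phi(u^{(j)})}\left(\frac1J\sum_{k=1}^J\|u^{(k)}-\bar u\|^2\right)^{3/2}.$$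
   Context: Let $n_x,K,J\in\mathbb N$ with $J\ge2$, let $y\in\mathbb R^K$ be fixed, let $G:\mathbb R^{n_x}\to\mathbb R^K$, and let $\Gamma\in\mathbb R^{K\times K}$ be symmetric positive definite. $\|\cdot\|$ is the Euclidean norm and $\|v\|_\Gamma=\|\Gamma^{-1/2}v\|$. Define $\Phi(x)=\frac12\|G(x)-y\|_\Gamma^2$. For an ensemble $u=(u^{(j)})_{j=1,\dots,J}$ in $\mathbb R^{n_x}$ put $\bar u=\frac1J\sum_{j}u^{(j)}$, $\bar G=\frac1J\sum_jG(u^{(j)})$, $C(u)=\frac1J\sum_j(u^{(j)}-\bar u)(u^{(j)}-\bar u)^\top$ and $C^{u,G}(u)=\frac1J\sum_j(u^{(j)}-\bar u)(G(u^{(j)})-\bar G)^\top$. *)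

theory Defs
  imports "HOL-Analysis.Analysis"
begin

definition C2_map :: "('a::real_normed_vector \<Rightarrow> 'b::real_normed_vector) \<Rightarrow> bool" where
  "C2_map f \<longleftrightarrow>
     (\<exists>(f' :: 'a \<Rightarrow> 'a \<Rightarrow>\<^sub>L 'b) (f'' :: 'a \<Rightarrow> 'a \<Rightarrow>\<^sub>L 'a \<Rightarrow>\<^sub>L 'b).
        (\<forall>x. (f has_derivative blinfun_apply (f' x)) (at x)) \<and>
        (\<forall>x. (f' has_derivative blinfun_apply (f'' x)) (at x)) \<and>
        continuous_on UNIV f'')"

(* The library's local_lipschitz lets the constant vary from point to point; here one
   constant c serves for a neighbourhood of every point. *)
definition locally_lipschitz_with :: "real \<Rightarrow> ('a::metric_space \<Rightarrow> 'b::metric_space) \<Rightarrow> bool" where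
  "locally_lipschitz_with c f \<longleftrightarrow> (\<forall>x. \<exists>e>0. lipschitz_on c (ball x e) f)"

definition gradient :: "('a::real_inner \<Rightarrow> real) \<Rightarrow> 'a \<Rightarrow> 'a" where
  "gradient f x = (THE D. GDERIV f x :> D)"

definition spd_matrix :: "real^'n^'n \<Rightarrow> bool" where
  "spd_matrix A \<longleftrightarrow> transpose A = A \<and> (\<forall>v. v \<noteq> 0 \<longrightarrow> v \<bullet> (A *v v) > 0)"

(* A symmetric positive definite matrix has exactly one symmetric positive definite square root. *)
definition spd_sqrt :: "real^'n^'n \<Rightarrow> real^'n^'n" where
  "spd_sqrt A = (THE S. spd_matrix S \<and> S ** S = A)"

definition weighted_norm :: "real^'k^'k \<Rightarrow> real^'k \<Rightarrow> real" where
  "weighted_norm \<Gamma> v = norm (matrix_inv (spd_sqrt \<Gamma>) *v v)"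

definition misfit :: "(real^'n \<Rightarrow> real^'k) \<Rightarrow> real^'k \<Rightarrow> real^'k^'k \<Rightarrow> real^'n \<Rightarrow> real" where
  "misfit G y \<Gamma> x = (1/2) * (weighted_norm \<Gamma> (G x - y))\<^sup>2"

(* The outer product v w^T. *)
definition outer :: "real^'m \<Rightarrow> real^'k \<Rightarrow> real^'k^'m" where
  "outer v w = (\<chi> a b. v $ a * w $ b)"

(* An ensemble of size J is a sequence of which only the entries with indices 1..J matter. *)
definition ens_mean :: "nat \<Rightarrow> (nat \<Rightarrow> 'a::real_vector) \<Rightarrow> 'a" where
  "ens_mean J u = (1 / real J) *\<^sub>R (\<Sum>j=1..J. u j)"

definition ens_cov :: "nat \<Rightarrow> (nat \<Rightarrow> real^'n) \<Rightarrow> real^'n^'n" where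
  "ens_cov J u =
     (1 / real J) *\<^sub>R (\<Sum>j=1..J. outer (u j - ens_mean J u) (u j - ens_mean J u))"

definition ens_cross_cov ::
  "nat \<Rightarrow> (real^'n \<Rightarrow> real^'k) \<Rightarrow> (nat \<Rightarrow> real^'n) \<Rightarrow> real^'k^'n" where
  "ens_cross_cov J G u =
     (1 / real J) *\<^sub>R
       (\<Sum>j=1..J. outer (u j - ens_mean J u) (G (u j) - ens_mean J (\<lambda>k. G (u k))))"

end

theory Submission
  imports Defs
begin

text \<open>
  Fix \<open>j\<close> and write \<open>a k = u k - ens_mean J u\<close>, \<open>w = \<Gamma>\<^sup>-\<^sup>1 (G (u j) - y)\<close> and \<open>V\<close> for the mean of
  the \<open>\<bar>a k\<bar>\<^sup>2\<close>. Since \<open>h \<bullet> \<nabla>\<Phi> (u j) = DG (u j) h \<bullet> w\<close>, the difference to be estimated is the mean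
  over \<open>k\<close> of \<open>((G (u k) - mean of G - DG (u j) (a k)) \<bullet> w) a k\<close>. The deviations \<open>a k\<close> sum to zero,
  so any vector independent of \<open>k\<close> may be added to the first factor of the inner product; this
  turns it into the Taylor remainder \<open>G (u k) - G (u j) - DG (u j) (u k - u j)\<close>, of norm at most
  \<open>b_res * \<bar>u k - u j\<bar>\<^sup>2\<close>. The conclusion follows from \<open>\<bar>u k - u j\<bar>\<^sup>2 \<le> 2 * J * V\<close> (lemma
  \<open>ens_dist_squared_le\<close>), the bound \<open>sqrt V\<close> for the mean of the \<open>\<bar>a k\<bar>\<close>, and
  \<open>\<bar>w\<bar> \<le> const * sqrt (\<Phi> (u j))\<close> (lemma \<open>norm_matrix_inv_le_sqrt_misfit\<close>).

  The misfit is defined through the square root of \<open>\<Gamma>\<close>, given by a definite description. Its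
  gradient can be computed only once that description is known to be proper, that is, once the
  positive definite square root is shown to exist and to be unique. Both facts rest on the
  spectral theorem, lemma \<open>self_adjoint_orthonormal_eigenbasis\<close>.
\<close>

section \<open>Orthonormal eigenbases of self-adjoint maps\<close>

text \<open>A maximiser of the Rayleigh quotient on the unit sphere of \<open>S\<close> is an eigenvector.\<close>

lemma self_adjoint_eigenvector:
  fixes f :: "'a::euclidean_space \<Rightarrow> 'a"
  assumes f: "linear f" and sa: "\<And>x y. x \<bullet> f y = f x \<bullet> y"
    and S: "subspace S" and inv: "f ` S \<subseteq> S" and nz: "S \<noteq> {0}"
  obtains v c where "v \<in> S" "norm v = 1" "f v = c *\<^sub>R v"
proof -
  have cont: "continuous_on T f" for T
    using f by (simp add: linear_continuous_on linear_linear)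
  obtain z where z: "z \<in> S" "z \<noteq> 0"
    using nz subspace_0[OF S] by auto
  have "compact (sphere 0 1 \<inter> S)"
    by (simp add: S closed_subspace compact_Int_closed)
  moreover have "sphere 0 1 \<inter> S \<noteq> {}"
  proof -
    have "(1 / norm z) *\<^sub>R z \<in> sphere 0 1 \<inter> S"
      using z S by (simp add: subspace_scale)
    then show ?thesis by blast
  qed
  moreover have "continuous_on (sphere 0 1 \<inter> S) (\<lambda>x. x \<bullet> f x)"
    by (intro continuous_intros cont)
  ultimately obtain v where "v \<in> sphere 0 1 \<inter> S"
    and sup: "\<forall>x\<in>sphere 0 1 \<inter> S. x \<bullet> f x \<le> v \<bullet> f v"
    using continuous_attains_sup[of "sphere 0 1 \<inter> S" "\<lambda>x. x \<bullet> f x"] by blast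
  then have v: "v \<in> S" "norm v = 1" by auto
  have max: "x \<bullet> f x \<le> v \<bullet> f v" if "x \<in> S" "norm x = 1" for x
    using sup that by simp
  define c where "c = v \<bullet> f v"
  \<comment> \<open>\<open>q\<close> is a nonnegative quadratic form on \<open>S\<close> that vanishes at \<open>v\<close>, so its gradient
    \<open>- 2 * w\<close> at \<open>v\<close> must vanish.\<close>
  define q where "q = (\<lambda>x. c * (x \<bullet> x) - x \<bullet> f x)"
  have q_nonneg: "q x \<ge> 0" if "x \<in> S" for x
  proof (cases "x = 0")
    case True
    then show ?thesis by (simp add: q_def)
  next
    case False
    have "((1 / norm x) *\<^sub>R x) \<bullet> f ((1 / norm x) *\<^sub>R x) \<le> c"
      unfolding c_def using that False S by (intro max) (auto simp: subspace_scale)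
    then have "(x \<bullet> f x) / (norm x)\<^sup>2 \<le> c"
      by (simp add: linear_cmul[OF f] power2_eq_square)
    then show ?thesis
      using False by (simp add: q_def divide_le_eq dot_square_norm)
  qed
  define w where "w = f v - c *\<^sub>R v"
  have wS: "w \<in> S"
    using v inv S by (auto simp: w_def intro!: subspace_diff subspace_scale)
  have vv: "v \<bullet> v = 1"
    using v by (simp add: dot_square_norm)
  have expand: "q (v + t *\<^sub>R w) = t\<^sup>2 * q w - 2 * t * (w \<bullet> w)" for t
  proof -
    have "w \<bullet> f v = w \<bullet> w + c * (v \<bullet> w)"
      by (simp add: w_def algebra_simps inner_commute)
    moreover have "v \<bullet> f w = w \<bullet> f v"
      using sa[of v w] by (simp only: inner_commute)
    ultimately show ?thesis
      using vv unfolding q_def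
      by (simp add: linear_add[OF f] linear_cmul[OF f] inner_simps inner_commute[of w v]
          c_def[symmetric] power2_eq_square algebra_simps)
  qed
  have "w \<bullet> w = 0"
  proof (rule ccontr)
    assume "w \<bullet> w \<noteq> 0"
    then have W: "w \<bullet> w > 0" by simp
    \<comment> \<open>A step length at which the linear term outweighs the quadratic one.\<close>
    define t where "t = (w \<bullet> w) / (q w + 1)"
    have qw: "q w \<ge> 0" using q_nonneg wS by blast
    then have t: "t > 0" "t * (q w + 1) = w \<bullet> w" using W by (auto simp: t_def)
    have "v + t *\<^sub>R w \<in> S"
      using v wS S by (simp add: subspace_add subspace_scale)
    then have "0 \<le> t * (t * q w - 2 * (w \<bullet> w))"
      using q_nonneg[of "v + t *\<^sub>R w"] expand[of t] by (simp add: power2_eq_square algebra_simps)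
    then have "2 * (w \<bullet> w) \<le> t * q w"
      using t(1) by (simp add: zero_le_mult_iff)
    with t W show False by (simp add: algebra_simps)
  qed
  then have "f v = c *\<^sub>R v" by (simp add: w_def)
  with v show thesis by (rule that)
qed

text \<open>
  The spectral theorem, by induction on the dimension of the invariant subspace: the orthogonal
  complement of an eigenvector within \<open>S\<close> is again invariant.
\<close>

theorem self_adjoint_orthonormal_eigenbasis:
  fixes f :: "'a::euclidean_space \<Rightarrow> 'a"
  assumes f: "linear f" and sa: "\<And>x y. x \<bullet> f y = f x \<bullet> y"
    and "subspace S" and "f ` S \<subseteq> S"
  shows "\<exists>B. finite B \<and> B \<subseteq> S \<and> pairwise orthogonal B \<and> S \<subseteq> span B \<and>
             (\<forall>b\<in>B. norm b = 1 \<and> (\<exists>c. f b = c *\<^sub>R b))"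
  using assms(3,4)
proof (induction "dim S" arbitrary: S rule: less_induct)
  case less
  show ?case
  proof (cases "S = {0}")
    case True
    then show ?thesis by (intro exI[of _ "{}"]) auto
  next
    case False
    obtain v c where v: "v \<in> S" "norm v = 1" "f v = c *\<^sub>R v"
      using self_adjoint_eigenvector[OF f sa less.prems False] by blast
    have vv: "v \<bullet> v = 1" using v by (simp add: dot_square_norm)
    define S' where "S' = S \<inter> {x. v \<bullet> x = 0}"
    have S': "subspace S'"
      unfolding S'_def by (rule subspace_inter[OF less.prems(1) subspace_hyperplane])
    have "f ` S' \<subseteq> S'"
      using less.prems v(3) by (auto simp: S'_def sa)
    moreover have "dim S' < dim S"
    proof (rule dim_psubset)
      have "v \<notin> S'" using vv by (simp add: S'_def)
      then have "S' \<subset> S" using v(1) unfolding S'_def by blast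
      then show "span S' \<subset> span S"
        using S' less.prems(1) by (metis span_eq_iff)
    qed
    ultimately obtain B where B: "finite B" "B \<subseteq> S'" "pairwise orthogonal B" "S' \<subseteq> span B"
      "\<forall>b\<in>B. norm b = 1 \<and> (\<exists>c. f b = c *\<^sub>R b)"
      using less.hyps[OF _ S'] by blast
    have "S \<subseteq> span (insert v B)"
    proof
      fix x assume x: "x \<in> S"
      have "x - (v \<bullet> x) *\<^sub>R v \<in> S'"
        using x v vv less.prems(1) by (simp add: S'_def subspace_diff subspace_scale inner_diff_right)
      then have "x - (v \<bullet> x) *\<^sub>R v \<in> span B" using B by blast
      then show "x \<in> span (insert v B)"
        by (auto simp: span_breakdown_eq)
    qed
    moreover have "pairwise orthogonal (insert v B)"
      using B by (auto simp: pairwise_insert orthogonal_def S'_def inner_commute)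
    ultimately show ?thesis
      using B v by (intro exI[of _ "insert v B"]) (auto simp: S'_def)
  qed
qed

section \<open>The square root of a positive definite matrix\<close>

lemma spd_matrix_inner:
  assumes "spd_matrix A"
  shows "x \<bullet> (A *v y) = (A *v x) \<bullet> y"
  using assms unfolding spd_matrix_def
  by (metis dot_lmul_matrix transpose_matrix_vector)

lemma spd_matrix_mul_matrix_inv:
  assumes "spd_matrix A"
  shows "A ** matrix_inv A = mat 1" "matrix_inv A ** A = mat 1"
proof -
  have "invertible A"
    unfolding invertible_left_inverse matrix_left_invertible_ker
    using assms unfolding spd_matrix_def by (metis inner_zero_right less_irrefl)
  then have "\<exists>A'. A ** A' = mat 1 \<and> A' ** A = mat 1"
    by (simp add: invertible_def)
  then show "A ** matrix_inv A = mat 1" "matrix_inv A ** A = mat 1"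
    unfolding matrix_inv_def by (metis (mono_tags, lifting) someI_ex)+
qed

lemma symmetric_matrix_eigenbasis:
  fixes A :: "real^'k^'k"
  assumes sym: "transpose A = A"
  obtains B :: "(real^'k) set" and c where "finite B" "pairwise orthogonal B" "span B = UNIV"
    "\<And>b. b \<in> B \<Longrightarrow> norm b = 1" "\<And>b. b \<in> B \<Longrightarrow> A *v b = c b *\<^sub>R b"
proof -
  have sa: "x \<bullet> (A *v y) = (A *v x) \<bullet> y" for x y
    using sym by (metis dot_lmul_matrix transpose_matrix_vector)
  obtain B where B: "finite B" "pairwise orthogonal B" "UNIV \<subseteq> span B"
    "\<forall>b\<in>B. norm b = 1 \<and> (\<exists>c. A *v b = c *\<^sub>R b)"
    using self_adjoint_orthonormal_eigenbasis[of "(*v) A" UNIV] sa by auto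
  then obtain c where "\<forall>b\<in>B. A *v b = c b *\<^sub>R b" by metis
  with B show thesis by (intro that[of B c]) auto
qed

lemma spd_square_root_exists:
  fixes A :: "real^'k^'k"
  assumes A: "spd_matrix A"
  shows "\<exists>S. spd_matrix S \<and> S ** S = A"
proof -
  obtain B c where B: "finite B" "pairwise orthogonal B" "span B = UNIV"
    "\<And>b. b \<in> B \<Longrightarrow> norm b = 1" and eig: "\<And>b. b \<in> B \<Longrightarrow> A *v b = c b *\<^sub>R b"
    using A symmetric_matrix_eigenbasis[of A] unfolding spd_matrix_def by metis
  have bb: "b \<bullet> b = 1" if "b \<in> B" for b using B(4)[OF that] by (simp add: dot_square_norm)
  have c_pos: "c b > 0" if "b \<in> B" for b
  proof -
    have "b \<noteq> 0" using bb[OF that] by auto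
    then have "0 < b \<bullet> (A *v b)" using A by (simp add: spd_matrix_def)
    then show ?thesis using eig[OF that] bb[OF that] by simp
  qed
  \<comment> \<open>\<open>g\<close> has the same eigenvectors as \<open>A\<close>, with eigenvalues \<open>sqrt (c b)\<close>.\<close>
  define g where "g = (\<lambda>x. \<Sum>b\<in>B. (sqrt (c b) * (b \<bullet> x)) *\<^sub>R b)"
  have g: "linear g"
    unfolding g_def
    by (rule linearI) (simp_all add: inner_add_right algebra_simps sum.distrib scaleR_sum_right)
  have g_eig: "g b = sqrt (c b) *\<^sub>R b" if "b \<in> B" for b
  proof -
    have "g b = (\<Sum>a\<in>B. if a = b then sqrt (c b) *\<^sub>R b else 0)"
      unfolding g_def using B(2) that bb
      by (intro sum.cong) (auto simp: pairwise_def orthogonal_def)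
    then show ?thesis using B(1) that by simp
  qed
  have g_inner: "x \<bullet> g y = (\<Sum>b\<in>B. sqrt (c b) * (b \<bullet> x) * (b \<bullet> y))" for x y
    unfolding g_def by (simp add: inner_sum_right inner_commute mult_ac)
  define S where "S = matrix g"
  have S: "S *v x = g x" for x unfolding S_def by (simp add: g matrix_works)
  have "g (g x) = A *v x" for x
  proof -
    have "linear (\<lambda>x. g (g x))" using linear_compose[OF g g] by (simp add: o_def)
    moreover have "g (g b) = A *v b" if "b \<in> B" for b
      using that c_pos[OF that] by (simp add: g_eig linear_cmul[OF g] eig)
    ultimately show ?thesis
      using B(3) linear_eq_on_span[of "\<lambda>x. g (g x)" "(*v) A" B x] by auto
  qed
  then have "S ** S = A"
    by (simp add: matrix_eq S flip: matrix_vector_mul_assoc)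
  moreover have "transpose S = S"
  proof -
    have "x \<bullet> (transpose S *v y) = x \<bullet> (S *v y)" for x y
    proof -
      have "x \<bullet> (transpose S *v y) = y \<bullet> g x"
        by (simp add: inner_commute[of x] dot_lmul_matrix S)
      also have "\<dots> = x \<bullet> g y" by (simp add: g_inner mult_ac)
      finally show ?thesis by (simp add: S)
    qed
    then show ?thesis by (metis matrix_eq vector_eq_ldot)
  qed
  moreover have "v \<bullet> (S *v v) > 0" if "v \<noteq> 0" for v
  proof -
    obtain b where b: "b \<in> B" "b \<bullet> v \<noteq> 0"
    proof (rule ccontr)
      assume "\<not> thesis"
      then have "\<And>b. b \<in> B \<Longrightarrow> orthogonal v b"
        using that by (metis inner_commute orthogonal_def)
      then have "orthogonal v v"
        using B(3) orthogonal_to_span[of v B v] by auto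
      with \<open>v \<noteq> 0\<close> show False by (simp add: orthogonal_def)
    qed
    have "0 < (\<Sum>b\<in>B. sqrt (c b) * (b \<bullet> v)\<^sup>2)"
      using B(1) b c_pos by (intro sum_pos2[of B b]) (auto simp: less_imp_le)
    then show ?thesis by (simp add: S g_inner power2_eq_square mult_ac)
  qed
  ultimately show ?thesis unfolding spd_matrix_def by blast
qed

lemma spd_square_root_unique:
  fixes S T :: "real^'k^'k"
  assumes S: "spd_matrix S" and T: "spd_matrix T" and eq: "S ** S = T ** T"
  shows "S = T"
proof -
  define D where "D = S - T"
  have D: "D *v x = S *v x - T *v x" for x
    by (simp add: D_def matrix_vector_mult_diff_rdistrib)
  have anti: "S *v (D *v x) + D *v (T *v x) = 0" for x
    using eq unfolding D by (simp add: matrix_vector_mult_diff_distrib matrix_vector_mul_assoc)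
  have "transpose D = D"
    using S T by (simp add: D_def spd_matrix_def transpose_def vec_eq_iff)
  then obtain B c where B: "span B = UNIV" "\<And>b. b \<in> B \<Longrightarrow> norm b = 1"
    and eig: "\<And>b. b \<in> B \<Longrightarrow> D *v b = c b *\<^sub>R b"
    using symmetric_matrix_eigenbasis[of D] by metis
  \<comment> \<open>Pairing \<open>S D + D T = 0\<close> with an eigenvector \<open>b\<close> of \<open>D\<close> shows that its eigenvalue is 0.\<close>
  have "D *v b = 0" if b: "b \<in> B" for b
  proof -
    have "b \<noteq> 0" using B(2)[OF b] by auto
    then have pos: "b \<bullet> (S *v b) + b \<bullet> (T *v b) > 0"
      using S T by (simp add: spd_matrix_def add_pos_pos)
    have "b \<bullet> (D *v (T *v b)) = (D *v b) \<bullet> (T *v b)"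
      using S T by (simp add: D inner_diff_right inner_diff_left spd_matrix_inner)
    then have "c b * (b \<bullet> (S *v b) + b \<bullet> (T *v b)) = b \<bullet> (S *v (D *v b) + D *v (T *v b))"
      by (simp add: eig[OF b] inner_add_right matrix_vector_mult_scaleR algebra_simps)
    then have "c b * (b \<bullet> (S *v b) + b \<bullet> (T *v b)) = 0" by (simp only: anti inner_zero_right)
    with pos have "c b = 0" by simp
    then show ?thesis by (simp add: eig[OF b])
  qed
  then have "D *v x = 0" for x
    using B(1) linear_eq_on_span[of "(*v) D" "\<lambda>_. 0" B x] by (auto simp: linear_zero)
  then show ?thesis by (simp add: matrix_eq D)
qed

lemma spd_sqrt_works:
  assumes "spd_matrix A"
  shows "spd_matrix (spd_sqrt A)" "spd_sqrt A ** spd_sqrt A = A"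
proof -
  have "\<exists>!S. spd_matrix S \<and> S ** S = A"
    using spd_square_root_exists[OF assms] spd_square_root_unique by metis
  then have "spd_matrix (spd_sqrt A) \<and> spd_sqrt A ** spd_sqrt A = A"
    unfolding spd_sqrt_def by (rule theI')
  then show "spd_matrix (spd_sqrt A)" "spd_sqrt A ** spd_sqrt A = A" by auto
qed

section \<open>The misfit and its gradient\<close>

lemma spd_matrix_matrix_inv_inner:
  assumes "spd_matrix A"
  shows "x \<bullet> (matrix_inv A *v y) = (matrix_inv A *v x) \<bullet> y"
proof -
  note inv = spd_matrix_mul_matrix_inv[OF assms]
  have "x \<bullet> (matrix_inv A *v y) = (A *v (matrix_inv A *v x)) \<bullet> (matrix_inv A *v y)"
    by (simp add: matrix_vector_mul_assoc inv)
  also have "\<dots> = (matrix_inv A *v x) \<bullet> (A *v (matrix_inv A *v y))"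
    by (simp add: spd_matrix_inner[OF assms])
  also have "\<dots> = (matrix_inv A *v x) \<bullet> y"
    by (simp add: matrix_vector_mul_assoc inv)
  finally show ?thesis .
qed

lemma matrix_inv_eq_square_spd_sqrt:
  assumes "spd_matrix A"
  shows "matrix_inv A *v v = matrix_inv (spd_sqrt A) *v (matrix_inv (spd_sqrt A) *v v)"
proof -
  let ?R = "matrix_inv (spd_sqrt A)"
  note S = spd_sqrt_works[OF assms]
  note R = spd_matrix_mul_matrix_inv[OF S(1)]
  have "A *v (?R *v (?R *v v)) = spd_sqrt A *v ((spd_sqrt A ** ?R) *v (?R *v v))"
    by (metis S(2) matrix_vector_mul_assoc)
  also have "\<dots> = v"
    by (simp add: R matrix_vector_mul_assoc)
  finally show ?thesis
    by (metis matrix_vector_mul_assoc matrix_vector_mul_lid spd_matrix_mul_matrix_inv(2)[OF assms])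
qed

lemma norm_matrix_inv_le_sqrt_misfit:
  assumes "spd_matrix \<Gamma>"
  shows "norm (matrix_inv \<Gamma> *v (G x - y))
         \<le> sqrt 2 * onorm ((*v) (matrix_inv (spd_sqrt \<Gamma>))) * sqrt (misfit G y \<Gamma> x)"
proof -
  let ?R = "matrix_inv (spd_sqrt \<Gamma>)"
  have "norm (?R *v (?R *v (G x - y))) \<le> onorm ((*v) ?R) * norm (?R *v (G x - y))"
    by (rule onorm) (simp add: linear_linear)
  also have "norm (?R *v (G x - y)) = sqrt 2 * sqrt (misfit G y \<Gamma> x)"
    by (simp add: misfit_def weighted_norm_def real_sqrt_divide)
  finally show ?thesis
    by (simp add: matrix_inv_eq_square_spd_sqrt[OF assms] mult_ac)
qed

lemma gradient_eqI:
  assumes "GDERIV f x :> D"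
  shows "gradient f x = D"
  unfolding gradient_def
proof (rule the_equality[where P = "\<lambda>D. GDERIV f x :> D", OF assms])
  fix E assume "GDERIV f x :> E"
  then have "(\<lambda>h. h \<bullet> E) = (\<lambda>h. h \<bullet> D)"
    using assms unfolding gderiv_def by (rule has_derivative_unique)
  then show "E = D" by (metis vector_eq_ldot)
qed

text \<open>
  The gradient is the adjoint of \<open>DG\<close> applied to \<open>\<Gamma>\<^sup>-\<^sup>1 (G x - y)\<close>, stated in its weak form, which
  avoids the adjoint.
\<close>

lemma inner_gradient_misfit:
  assumes \<Gamma>: "spd_matrix \<Gamma>" and G: "(G has_derivative G') (at x)"
  shows "h \<bullet> gradient (misfit G y \<Gamma>) x = G' h \<bullet> (matrix_inv \<Gamma> *v (G x - y))"
proof -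
  let ?R = "matrix_inv (spd_sqrt \<Gamma>)"
  have misfit: "misfit G y \<Gamma> = (\<lambda>x. (1/2) * ((?R *v (G x - y)) \<bullet> (?R *v (G x - y))))"
    by (simp add: fun_eq_iff misfit_def weighted_norm_def dot_square_norm)
  have R: "((\<lambda>x. ?R *v (G x - y)) has_derivative (\<lambda>h. ?R *v G' h)) (at x)"
    by (rule bounded_linear.has_derivative[of "(*v) ?R"])
      (auto intro!: derivative_eq_intros G simp: linear_linear)
  have "(misfit G y \<Gamma> has_derivative (\<lambda>h. (?R *v G' h) \<bullet> (?R *v (G x - y)))) (at x)"
    unfolding misfit
    by (rule has_derivative_eq_rhs[OF has_derivative_mult_right[OF has_derivative_inner[OF R R]]])
      (simp add: inner_commute)
  moreover have "(?R *v G' h) \<bullet> (?R *v (G x - y)) = h \<bullet> adjoint G' (matrix_inv \<Gamma> *v (G x - y))" for h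
    using has_derivative_linear[OF G]
    by (simp add: adjoint_works matrix_inv_eq_square_spd_sqrt[OF \<Gamma>]
        spd_matrix_matrix_inv_inner[OF spd_sqrt_works(1)[OF \<Gamma>]])
  ultimately have "GDERIV (misfit G y \<Gamma>) x :> adjoint G' (matrix_inv \<Gamma> *v (G x - y))"
    by (simp add: gderiv_def)
  then show ?thesis
    using has_derivative_linear[OF G] by (simp add: gradient_eqI adjoint_works)
qed

section \<open>Empirical covariances\<close>

lemma outer_mult_vector: "outer a b *v w = (b \<bullet> w) *\<^sub>R a"
  by (simp add: vec_eq_iff outer_def matrix_vector_mult_def inner_vec_def sum_distrib_left mult_ac)

lemma sum_matrix_vector_mult:
  fixes A :: "'i \<Rightarrow> real^'n^'m"
  shows "(\<Sum>i\<in>I. A i) *v w = (\<Sum>i\<in>I. A i *v w)"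
  by (induction I rule: infinite_finite_induct) (auto simp: matrix_vector_mult_add_rdistrib)

lemma ens_cross_cov_mult:
  "ens_cross_cov J G u *v w =
     (1 / real J) *\<^sub>R (\<Sum>k=1..J. ((G (u k) - ens_mean J (\<lambda>k. G (u k))) \<bullet> w) *\<^sub>R (u k - ens_mean J u))"
  by (simp add: ens_cross_cov_def scaleR_matrix_vector_assoc[symmetric] sum_matrix_vector_mult
      outer_mult_vector)

lemma ens_cov_mult:
  "ens_cov J u *v w =
     (1 / real J) *\<^sub>R (\<Sum>k=1..J. ((u k - ens_mean J u) \<bullet> w) *\<^sub>R (u k - ens_mean J u))"
  by (simp add: ens_cov_def scaleR_matrix_vector_assoc[symmetric] sum_matrix_vector_mult
      outer_mult_vector)

lemma sum_deviations_eq_0: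
  assumes "J > 0"
  shows "(\<Sum>k=1..J. u k - ens_mean J u) = 0"
  using assms by (simp add: ens_mean_def sum_subtractf scaleR_conv_of_real sum_constant_scaleR)

lemma mean_le_sqrt_mean_squares:
  fixes f :: "nat \<Rightarrow> real"
  assumes "J > 0"
  shows "(1 / real J) * (\<Sum>k=1..J. f k) \<le> sqrt ((1 / real J) * (\<Sum>k=1..J. (f k)\<^sup>2))"
proof (rule real_le_rsqrt)
  have "(\<Sum>k=1..J. f k)\<^sup>2 \<le> (\<Sum>k=1..J. (f k)\<^sup>2) * real J"
    using sum_squared_le_sum_of_squares[of f "{1..J}"] by simp
  then show "((1 / real J) * (\<Sum>k=1..J. f k))\<^sup>2 \<le> (1 / real J) * (\<Sum>k=1..J. (f k)\<^sup>2)"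
    using assms by (simp add: power2_eq_square field_simps)
qed

text \<open>
  For \<open>k \<noteq> j\<close> the squared deviations of \<open>u k\<close> and \<open>u j\<close> are two different terms of the sum. This
  bound, a sum instead of a mean, is where the factor \<open>J\<close> of the final estimate arises.
\<close>

lemma ens_dist_squared_le:
  fixes u :: "nat \<Rightarrow> 'a::real_normed_vector"
  assumes "j \<in> {1..J}" "k \<in> {1..J}"
  shows "(norm (u k - u j))\<^sup>2 \<le> 2 * (\<Sum>i=1..J. (norm (u i - ens_mean J u))\<^sup>2)"
proof (cases "k = j")
  case True
  then show ?thesis by (simp add: sum_nonneg)
next
  case False
  let ?a = "\<lambda>i. norm (u i - ens_mean J u)"
  have "norm (u k - u j) \<le> ?a k + ?a j"
    by (metis norm_diff_triangle_ineq norm_minus_commute norm_triangle_sub dist_norm dist_triangle2)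
  then have "(norm (u k - u j))\<^sup>2 \<le> (?a k + ?a j)\<^sup>2" by (simp add: power_mono)
  also have "\<dots> \<le> 2 * ((?a k)\<^sup>2 + (?a j)\<^sup>2)"
    by (smt (verit) sum_squares_bound power2_sum)
  also have "(?a k)\<^sup>2 + (?a j)\<^sup>2 = (\<Sum>i\<in>{k,j}. (?a i)\<^sup>2)" using False by simp
  also have "\<dots> \<le> (\<Sum>i=1..J. (?a i)\<^sup>2)" using assms by (intro sum_mono2) auto
  finally show ?thesis by simp
qed

section \<open>Accuracy of the derivative-free preconditioned gradient\<close>

theorem lemma4p5:
  fixes G :: "real^'n \<Rightarrow> real^'k"
    and y :: "real^'k"
    and \<Gamma> :: "real^'k^'k"
    and c_lip b_res :: real
  assumes "spd_matrix \<Gamma>"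
    and "C2_map G"
    and "c_lip > 0"
    and "locally_lipschitz_with c_lip G"
    and "b_res > 0"
    and "\<And>x1 x2. norm (G x1 - G x2 - frechet_derivative G (at x2) (x1 - x2))
                   \<le> b_res * (norm (x1 - x2))\<^sup>2"
  shows "\<exists>b1>0. \<forall>J\<ge>2. \<forall>u :: nat \<Rightarrow> real^'n. \<forall>j\<in>{1..J}.
           norm (ens_cross_cov J G u *v (matrix_inv \<Gamma> *v (G (u j) - y))
                 - ens_cov J u *v gradient (misfit G y \<Gamma>) (u j))
           \<le> b1 * real J * sqrt (misfit G y \<Gamma> (u j))
               * ((1 / real J) * (\<Sum>k=1..J. (norm (u k - ens_mean J u))\<^sup>2)) powr (3/2)"
proof -
  define DG where "DG x = frechet_derivative G (at x)" for x
  have DG: "(G has_derivative DG x) (at x)" for x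
    using \<open>C2_map G\<close> unfolding DG_def C2_map_def
    by (metis differentiableI frechet_derivative_works)
  define r where "r = sqrt 2 * onorm ((*v) (matrix_inv (spd_sqrt \<Gamma>)))"
  have r: "r \<ge> 0" unfolding r_def by (simp add: onorm_pos_le linear_linear)
  \<comment> \<open>The summand 1 only makes the constant positive.\<close>
  define b1 where "b1 = 2 * b_res * r + 1"
  have "b1 > 0" using r \<open>b_res > 0\<close> by (simp add: b1_def add_nonneg_pos)
  moreover
  have "norm (ens_cross_cov J G u *v (matrix_inv \<Gamma> *v (G (u j) - y))
                 - ens_cov J u *v gradient (misfit G y \<Gamma>) (u j))
           \<le> b1 * real J * sqrt (misfit G y \<Gamma> (u j))
               * ((1 / real J) * (\<Sum>k=1..J. (norm (u k - ens_mean J u))\<^sup>2)) powr (3/2)"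
    if J: "J \<ge> 2" and j: "j \<in> {1..J}" for J j and u :: "nat \<Rightarrow> real^'n"
  proof -
    define w where "w = matrix_inv \<Gamma> *v (G (u j) - y)"
    define a where "a k = u k - ens_mean J u" for k
    define V where "V = (1 / real J) * (\<Sum>k=1..J. (norm (a k))\<^sup>2)"
    define \<rho> where "\<rho> k = G (u k) - G (u j) - DG (u j) (u k - u j)" for k
    define e where "e = G (u j) - ens_mean J (\<lambda>k. G (u k)) + DG (u j) (ens_mean J u - u j)"
    have V: "V \<ge> 0" by (simp add: V_def sum_nonneg)
    have JV: "(\<Sum>k=1..J. (norm (a k))\<^sup>2) = real J * V" using J by (simp add: V_def)
    have lin: "linear (DG (u j))" using DG has_derivative_linear by blast
    have grad: "h \<bullet> gradient (misfit G y \<Gamma>) (u j) = DG (u j) h \<bullet> w" for h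
      unfolding w_def by (rule inner_gradient_misfit[OF \<open>spd_matrix \<Gamma>\<close> DG])
    \<comment> \<open>Up to the vector \<open>e\<close>, which does not depend on \<open>k\<close>, the summands are Taylor remainders.\<close>
    have split: "(G (u k) - ens_mean J (\<lambda>k. G (u k))) \<bullet> w - DG (u j) (a k) \<bullet> w
                 = \<rho> k \<bullet> w + e \<bullet> w" for k
      by (simp add: \<rho>_def e_def a_def linear_diff[OF lin] algebra_simps)
    have bound: "norm (\<Sum>k=1..J. (\<rho> k \<bullet> w) *\<^sub>R a k)
               \<le> (\<Sum>k=1..J. b_res * (2 * (real J * V)) * norm w * norm (a k))"
    proof (rule sum_norm_le)
      fix k assume k: "k \<in> {1..J}"
      have "norm (\<rho> k) \<le> b_res * (norm (u k - u j))\<^sup>2"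
        unfolding \<rho>_def DG_def by (rule assms(6))
      also have "\<dots> \<le> b_res * (2 * (real J * V))"
        using ens_dist_squared_le[OF j k, of u] \<open>b_res > 0\<close> unfolding JV[symmetric] a_def by simp
      finally have "\<bar>\<rho> k \<bullet> w\<bar> \<le> b_res * (2 * (real J * V)) * norm w"
        by (meson Cauchy_Schwarz_ineq2 mult_right_mono norm_ge_zero order_trans)
      then show "norm ((\<rho> k \<bullet> w) *\<^sub>R a k) \<le> b_res * (2 * (real J * V)) * norm w * norm (a k)"
        by (simp add: mult_right_mono)
    qed
    have "ens_cross_cov J G u *v w - ens_cov J u *v gradient (misfit G y \<Gamma>) (u j)
          = (1 / real J) *\<^sub>R (\<Sum>k=1..J. (\<rho> k \<bullet> w + e \<bullet> w) *\<^sub>R a k)"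
      unfolding ens_cross_cov_mult ens_cov_mult grad a_def[symmetric] split[symmetric]
      by (simp add: scaleR_diff_left sum_subtractf scaleR_diff_right)
    also have "(\<Sum>k=1..J. (\<rho> k \<bullet> w + e \<bullet> w) *\<^sub>R a k)
               = (\<Sum>k=1..J. (\<rho> k \<bullet> w) *\<^sub>R a k) + (e \<bullet> w) *\<^sub>R (\<Sum>k=1..J. a k)"
      by (simp add: scaleR_add_left sum.distrib scaleR_sum_right)
    also have "(\<Sum>k=1..J. a k) = 0"
      unfolding a_def using J by (intro sum_deviations_eq_0) simp
    finally have "norm (ens_cross_cov J G u *v w - ens_cov J u *v gradient (misfit G y \<Gamma>) (u j))
          = (1 / real J) * norm (\<Sum>k=1..J. (\<rho> k \<bullet> w) *\<^sub>R a k)"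
      by simp
    also have "\<dots> \<le> (1 / real J) * (\<Sum>k=1..J. b_res * (2 * (real J * V)) * norm w * norm (a k))"
      using bound by (intro mult_left_mono) auto
    also have "\<dots> = 2 * b_res * real J * V * norm w * ((1 / real J) * (\<Sum>k=1..J. norm (a k)))"
      by (simp add: sum_distrib_left mult_ac)
    also have "\<dots> \<le> 2 * b_res * real J * V * norm w * sqrt V"
    proof (rule mult_left_mono)
      show "(1 / real J) * (\<Sum>k=1..J. norm (a k)) \<le> sqrt V"
        unfolding V_def using J by (intro mean_le_sqrt_mean_squares) simp
    qed (use V \<open>b_res > 0\<close> in simp)
    also have "\<dots> \<le> 2 * b_res * real J * V * (r * sqrt (misfit G y \<Gamma> (u j))) * sqrt V"
      unfolding w_def r_def using V \<open>b_res > 0\<close>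
      by (intro mult_right_mono mult_left_mono norm_matrix_inv_le_sqrt_misfit assms) auto
    also have "\<dots> = (2 * b_res * r) * (real J * sqrt (misfit G y \<Gamma> (u j)) * (V * sqrt V))"
      by (simp add: mult_ac)
    also have "\<dots> \<le> b1 * (real J * sqrt (misfit G y \<Gamma> (u j)) * (V * sqrt V))"
      using V by (intro mult_right_mono) (auto simp: b1_def misfit_def)
    also have "V * sqrt V = V powr (3/2)"
      using V powr_add[of V 1 "1/2"] by (simp add: powr_half_sqrt)
    finally show ?thesis
      by (simp add: w_def V_def a_def mult_ac)
  qed
  ultimately show ?thesis by blast
qed

end
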